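(* For the iterates of the private gossip algorithm with $\epsilon$-gap oracle, for all $k\ge1$, $$\delta^k(\epsilon)\le\frac{4\left(D(y^* )-D(y^0)\right)}{k\,\epsilon^2},\qquad\text{where}\quad \delta^k(\epsilon)=\mathbb{E}\left[\frac1k\sum_{t=0}^{k-1}\Delta^t(\epsilon)\right].$$
   Context: $\mathcal G=(\mathcal V,\mathcal E)$ is an undirected connected (simple) graph with $\mathcal V=\{1,\dots,n\}$, $n\ge2$, $|\mathcal E|=m$. Each edge is written $e=(i,j)$ with a fixed orientation. $\mathbf A\in\mathbb{R}^{m\times n}$ is the incidence matrix: row $e=(i,j)$ has $\mathbf A_{ei}=1$, $\mathbf A_{ej}=-1$ and all other entries $0$; $f_e\in\mathbb{R}^m$ is the unit basis vector indexed by $e$. $c\in\mathbb{R}^n$ is the vector of initial values, $D(y)=-(\mathbf A c)^\top y-\frac12\|\mathbf A^\top y\|^2$, and $y^*$ is a maximizer of $D$ over $\mathbb{R}^m$. Private gossip with $\epsilon$-gap oracle ($\epsilon>0$): set $y^0=0\in\mathbb{R}^m$, $x^0=c$. In each iteration $t=0,1,\dots$ choose $e=(i,j)\in\mathcal E$ uniformly at random, independently of the past. If $x^t_i-x^t_j\le-\epsilon$ set $y^{t+1}=y^t+\frac\epsilon2f_e$; if $x^t_j-x^t_i\le-\epsilon$ set $y^{t+1}=y^t-\frac\epsilon2f_e$; otherwise $y^{t+1}=y^t$. Then $x^{t+1}=c+\mathbf A^\top y^{t+1}$ (i.e. the smaller of the two values is increased by $\epsilon/2$ and the larger decreased by $\epsilon/2$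 if they differ by at least $\epsilon$; nothing changes otherwise). $\Delta^t(\epsilon)=\frac1m\sum_{e\in\mathcal E}\Delta^t_e(\epsilon)$, where for $e=(i,j)$, $\Delta^t_e(\epsilon)=1$ if $|x^t_i-x^t_j|\ge\epsilon$ and $0$ otherwise. *)

theory Defs
  imports "HOL-Probability.Probability"
begin

text \<open>
  The vertex set is the finite type \<open>'v\<close>, so \<open>n = CARD('v)\<close>. A simple graph on it is its set \<open>E\<close>
  of two-element vertex sets. The finite type \<open>'e\<close> indexes \<open>E\<close>, so \<open>m = CARD('e)\<close>; the edge \<open>e\<close>
  with its fixed orientation \<open>(i, j)\<close> is given by \<open>i = src e\<close> and \<open>j = dst e\<close>.
\<close>

definition simple_graph :: "'v set set \<Rightarrow> bool" where
  "simple_graph E \<longleftrightarrow> (\<forall>a\<in>E. card a = 2)"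

definition connected_graph :: "'v set set \<Rightarrow> bool" where
  "connected_graph E \<longleftrightarrow> (\<forall>u v. (u, v) \<in> {(a, b). {a, b} \<in> E}\<^sup>*)"

text \<open>
  Bijectivity makes every edge of \<open>E\<close> occur exactly once, in exactly one of its two orientations.
\<close>

definition oriented_edges :: "'v set set \<Rightarrow> ('e \<Rightarrow> 'v) \<Rightarrow> ('e \<Rightarrow> 'v) \<Rightarrow> bool" where
  "oriented_edges E src dst \<longleftrightarrow> bij_betw (\<lambda>e. {src e, dst e}) UNIV E"

definition incidence ::
    "('e::finite \<Rightarrow> 'v::finite) \<Rightarrow> ('e \<Rightarrow> 'v) \<Rightarrow> real ^ 'v ^ 'e" where
  "incidence src dst = (\<chi> e v. if v = src e then 1 else if v = dst e then - 1 else 0)"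

definition dual_obj ::
    "('e::finite \<Rightarrow> 'v::finite) \<Rightarrow> ('e \<Rightarrow> 'v) \<Rightarrow> real ^ 'v \<Rightarrow> real ^ 'e \<Rightarrow> real" where
  "dual_obj src dst c y =
     - ((incidence src dst *v c) \<bullet> y)
     - 1 / 2 * (norm (transpose (incidence src dst) *v y))\<^sup>2"

definition primal_of ::
    "('e::finite \<Rightarrow> 'v::finite) \<Rightarrow> ('e \<Rightarrow> 'v) \<Rightarrow> real ^ 'v \<Rightarrow> real ^ 'e \<Rightarrow> real ^ 'v" where
  "primal_of src dst c y = c + transpose (incidence src dst) *v y"

definition gossip_step ::
    "('e::finite \<Rightarrow> 'v::finite) \<Rightarrow> ('e \<Rightarrow> 'v) \<Rightarrow> real \<Rightarrow> 'e \<Rightarrow> real ^ 'v \<Rightarrow> real ^ 'e \<Rightarrow> real ^ 'e" where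
  "gossip_step src dst \<epsilon> e x y =
     (if x $ src e - x $ dst e \<le> - \<epsilon> then y + (\<epsilon> / 2) *\<^sub>R axis e 1
      else if x $ dst e - x $ src e \<le> - \<epsilon> then y - (\<epsilon> / 2) *\<^sub>R axis e 1
      else y)"

text \<open>The iterates, as functions of the sequence \<open>w\<close> of selected edges.\<close>

primrec gossip_y ::
    "('e::finite \<Rightarrow> 'v::finite) \<Rightarrow> ('e \<Rightarrow> 'v) \<Rightarrow> real ^ 'v \<Rightarrow> real \<Rightarrow> (nat \<Rightarrow> 'e) \<Rightarrow> nat \<Rightarrow> real ^ 'e" where
  "gossip_y src dst c \<epsilon> w 0 = 0"
| "gossip_y src dst c \<epsilon> w (Suc t) =
     gossip_step src dst \<epsilon> (w t)
       (primal_of src dst c (gossip_y src dst c \<epsilon> w t)) (gossip_y src dst c \<epsilon> w t)"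

definition gossip_x ::
    "('e::finite \<Rightarrow> 'v::finite) \<Rightarrow> ('e \<Rightarrow> 'v) \<Rightarrow> real ^ 'v \<Rightarrow> real \<Rightarrow> (nat \<Rightarrow> 'e) \<Rightarrow> nat \<Rightarrow> real ^ 'v" where
  "gossip_x src dst c \<epsilon> w t = primal_of src dst c (gossip_y src dst c \<epsilon> w t)"

lemma gossip_x_0: "gossip_x src dst c \<epsilon> w 0 = c"
  by (simp add: gossip_x_def primal_of_def)

definition gap_edge ::
    "('e::finite \<Rightarrow> 'v::finite) \<Rightarrow> ('e \<Rightarrow> 'v) \<Rightarrow> real \<Rightarrow> real ^ 'v \<Rightarrow> 'e \<Rightarrow> real" where
  "gap_edge src dst \<epsilon> x e = (if \<bar>x $ src e - x $ dst e\<bar> \<ge> \<epsilon> then 1 else 0)"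

definition gap ::
    "('e::finite \<Rightarrow> 'v::finite) \<Rightarrow> ('e \<Rightarrow> 'v) \<Rightarrow> real \<Rightarrow> real ^ 'v \<Rightarrow> real" where
  "gap src dst \<epsilon> x = 1 / real CARD('e) * (\<Sum>e\<in>UNIV. gap_edge src dst \<epsilon> x e)"

text \<open>
  The edges selected in the successive iterations, as random variables on a probability space \<open>M\<close>.
  Measurability of each \<open>\<xi> t\<close> is part of \<open>indep_vars\<close>.
\<close>

definition iid_uniform :: "'a measure \<Rightarrow> (nat \<Rightarrow> 'a \<Rightarrow> 'e::finite) \<Rightarrow> bool" where
  "iid_uniform M \<xi> \<longleftrightarrow>
     prob_space.indep_vars M (\<lambda>_. count_space UNIV) \<xi> UNIV \<and>
     (\<forall>t. distr M (count_space UNIV) (\<xi> t) = uniform_count_measure UNIV)"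

definition avg_gap ::
    "'a measure \<Rightarrow> (nat \<Rightarrow> 'a \<Rightarrow> 'e::finite) \<Rightarrow> ('e \<Rightarrow> 'v::finite) \<Rightarrow> ('e \<Rightarrow> 'v) \<Rightarrow>
     real ^ 'v \<Rightarrow> real \<Rightarrow> nat \<Rightarrow> real" where
  "avg_gap M \<xi> src dst c \<epsilon> k =
     prob_space.expectation M (\<lambda>\<omega>.
       1 / real k * (\<Sum>t<k. gap src dst \<epsilon> (gossip_x src dst c \<epsilon> (\<lambda>s. \<xi> s \<omega>) t)))"

end

theory Submission
  imports Defs
begin

text \<open>
  In the dual variables the algorithm is a coordinate ascent on \<open>D\<close>, for which \<open>- (x\<^sub>i - x\<^sub>j)\<close> is
  the partial derivative in the coordinate of the edge \<open>(i, j)\<close> and \<open>- 2\<close> is the curvature. A step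
  of length \<open>\<epsilon>/2\<close> in an ascent direction of slope at least \<open>\<epsilon>\<close> therefore gains at least
  \<open>\<epsilon>\<^sup>2/2 - \<epsilon>\<^sup>2/4 = \<epsilon>\<^sup>2/4\<close> (\<open>dual_obj_gossip_step\<close>), and the gap indicator of the selected edge tells
  whether such a step is made. As \<open>D\<close> never exceeds \<open>D(y*)\<close>, telescoping bounds the number of
  effective steps by \<open>4 (D(y*) - D(y\<^sup>0)) / \<epsilon>\<^sup>2\<close> along every selection sequence, with no probability
  involved (\<open>effective_steps_le\<close>).

  Randomness only relates the indicator of the selected edge to the average over all edges: the
  iterate at time \<open>t\<close> is a function of the selections before \<open>t\<close>, which are independent of the
  uniform selection at time \<open>t\<close>, so both have the same expectation (\<open>expectation_fresh_uniform\<close>).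
\<close>

section \<open>Ascent of the dual objective\<close>

lemma inner_transpose_axis:
  fixes A :: "real ^ 'n ^ 'm"
  shows "x \<bullet> (transpose A *v axis i 1) = (A *v x) $ i"
  by (metis cart_eq_inner_axis dot_lmul_matrix inner_commute transpose_matrix_vector)

text \<open>
  The expansion of \<open>D\<close> is exact because \<open>D\<close> is quadratic; the gradient at \<open>y\<close> is minus \<open>A\<close>
  applied to the primal vector of \<open>y\<close>.
\<close>

lemma dual_obj_add:
  "dual_obj src dst c (y + u) = dual_obj src dst c y
     - primal_of src dst c y \<bullet> (transpose (incidence src dst) *v u)
     - 1 / 2 * (norm (transpose (incidence src dst) *v u))\<^sup>2"
proof -
  let ?A = "incidence src dst"
  have "(?A *v c) \<bullet> u = c \<bullet> (transpose ?A *v u)"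
    by (metis dot_lmul_matrix inner_commute transpose_matrix_vector)
  then show ?thesis
    unfolding dual_obj_def primal_of_def power2_norm_eq_inner
    by (simp add: matrix_vector_right_distrib inner_add_left inner_add_right
        inner_commute algebra_simps)
qed

lemma incidence_mult:
  assumes "src e \<noteq> dst e"
  shows "(incidence src dst *v x) $ e = x $ src e - x $ dst e"
proof -
  have "(incidence src dst *v x) $ e =
      (\<Sum>v\<in>UNIV. (if v = src e then x $ v else 0) - (if v = dst e then x $ v else 0))"
    unfolding matrix_vector_mult_def incidence_def
    using assms by (auto intro!: sum.cong)
  then show ?thesis by (simp add: sum_subtractf)
qed

lemma dual_obj_add_axis:
  fixes src dst :: "'e::finite \<Rightarrow> 'v::finite" and c :: "real ^ 'v" and y :: "real ^ 'e"
  assumes "src e \<noteq> dst e"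
  defines "x \<equiv> primal_of src dst c y"
  shows "dual_obj src dst c (y + h *\<^sub>R axis e 1)
    = dual_obj src dst c y - h * (x $ src e - x $ dst e) - h\<^sup>2"
proof -
  let ?A = "incidence src dst"
  let ?a = "transpose ?A *v axis e 1"
  have entry: "?a $ v = ?A $ e $ v" for v
    by (simp add: matrix_vector_mult_basis column_def transpose_def)
  have "(norm ?a)\<^sup>2 = ?a $ src e - ?a $ dst e"
    unfolding power2_norm_eq_inner inner_transpose_axis by (rule incidence_mult) fact
  also have "\<dots> = 2"
    unfolding entry using assms by (simp add: incidence_def)
  finally have "(norm ?a)\<^sup>2 = 2" .
  moreover have "transpose ?A *v (h *\<^sub>R axis e 1) = h *\<^sub>R ?a"
    by (simp add: matrix_vector_mult_scaleR)
  moreover have "x \<bullet> ?a = x $ src e - x $ dst e"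
    unfolding inner_transpose_axis by (rule incidence_mult) fact
  ultimately show ?thesis
    unfolding x_def by (simp add: dual_obj_add power_mult_distrib)
qed

lemma dual_obj_gossip_step:
  fixes src dst :: "'e::finite \<Rightarrow> 'v::finite" and c :: "real ^ 'v" and y :: "real ^ 'e"
  assumes "src e \<noteq> dst e" and "\<epsilon> > 0"
  defines "x \<equiv> primal_of src dst c y"
  shows "dual_obj src dst c y + \<epsilon>\<^sup>2 / 4 * gap_edge src dst \<epsilon> x e
    \<le> dual_obj src dst c (gossip_step src dst \<epsilon> e x y)"
proof -
  have up: "\<epsilon>\<^sup>2 / 4 \<le> - (\<epsilon> / 2) * d - (\<epsilon> / 2)\<^sup>2" if "d \<le> - \<epsilon>" for d
    using mult_left_mono[OF that, of "\<epsilon> / 2"] assms(2) by (simp add: power2_eq_square)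
  have "dual_obj src dst c (y - (\<epsilon> / 2) *\<^sub>R axis e 1)
      = dual_obj src dst c y - (- (\<epsilon> / 2)) * (x $ src e - x $ dst e) - (\<epsilon> / 2)\<^sup>2"
    using dual_obj_add_axis[of src e dst c y "- (\<epsilon> / 2)"] assms by simp
  moreover have "dual_obj src dst c (y + (\<epsilon> / 2) *\<^sub>R axis e 1)
      = dual_obj src dst c y - (\<epsilon> / 2) * (x $ src e - x $ dst e) - (\<epsilon> / 2)\<^sup>2"
    using dual_obj_add_axis[of src e dst c y "\<epsilon> / 2"] assms by simp
  ultimately show ?thesis
    using up[of "x $ src e - x $ dst e"] up[of "x $ dst e - x $ src e"] assms(2)
    unfolding gossip_step_def gap_edge_def by (auto simp: algebra_simps abs_if)
qed

text \<open>The pathwise bound: each effective step consumes \<open>\<epsilon>\<^sup>2/4\<close> of a bounded dual budget.\<close>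

lemma effective_steps_le:
  assumes "\<And>e. src e \<noteq> dst e" and "\<epsilon> > 0"
    and "\<And>y. dual_obj src dst c y \<le> B"
  shows "(\<Sum>t<k. gap_edge src dst \<epsilon> (gossip_x src dst c \<epsilon> w t) (w t))
    \<le> 4 * (B - dual_obj src dst c 0) / \<epsilon>\<^sup>2"
proof -
  let ?D = "\<lambda>t. dual_obj src dst c (gossip_y src dst c \<epsilon> w t)"
  let ?g = "\<lambda>t. gap_edge src dst \<epsilon> (gossip_x src dst c \<epsilon> w t) (w t)"
  have "\<epsilon>\<^sup>2 / 4 * ?g t \<le> ?D (Suc t) - ?D t" for t
    using dual_obj_gossip_step[of src "w t" dst \<epsilon> c "gossip_y src dst c \<epsilon> w t"] assms(1,2)
    by (simp add: gossip_x_def)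
  then have "(\<Sum>t<k. \<epsilon>\<^sup>2 / 4 * ?g t) \<le> (\<Sum>t<k. ?D (Suc t) - ?D t)"
    by (intro sum_mono)
  also have "\<dots> = ?D k - ?D 0"
    by (rule sum_lessThan_telescope)
  also have "\<dots> \<le> B - dual_obj src dst c 0"
    using assms(3) by simp
  finally show ?thesis
    unfolding sum_distrib_left[symmetric] using assms(2) by (simp add: field_simps)
qed

section \<open>Averaging over a fresh uniform selection\<close>

text \<open>
  Functions of finitely many selections from a finite set take finitely many values, hence are
  measurable and integrable whatever they are. Restricting the selections to the times before \<open>t\<close>
  brings them into such a finite set, without changing the value of \<open>F\<close>.
\<close>

lemma (in prob_space)
  fixes X :: "nat \<Rightarrow> 'a \<Rightarrow> 'e::finite" and F :: "(nat \<Rightarrow> 'e) \<Rightarrow> real"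
  assumes X: "\<And>s. X s \<in> measurable M (count_space UNIV)"
    and past: "\<And>w w'. (\<And>s. s < t \<Longrightarrow> w s = w' s) \<Longrightarrow> F w = F w'"
  shows measurable_past: "F \<in> borel_measurable (PiM {..<t} (\<lambda>_. count_space UNIV))"
    and integrable_past: "integrable M (\<lambda>\<omega>. F (\<lambda>s. X s \<omega>))"
proof -
  let ?P = "PiE {..<t} (\<lambda>_. UNIV :: 'e set)"
  show meas: "F \<in> borel_measurable (PiM {..<t} (\<lambda>_. count_space UNIV))"
    by (simp add: count_space_PiM_finite)
  have eq: "F (\<lambda>s. X s \<omega>) = F (restrict (\<lambda>s. X s \<omega>) {..<t})" for \<omega>
    by (rule past) simp
  have fin: "finite ?P" by (intro finite_PiE) auto
  show "integrable M (\<lambda>\<omega>. F (\<lambda>s. X s \<omega>))"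
  proof (rule integrable_const_bound)
    show "AE \<omega> in M. norm (F (\<lambda>s. X s \<omega>)) \<le> Max ((\<lambda>w. norm (F w)) ` ?P)"
      unfolding eq by (intro AE_I2 Max_ge finite_imageI fin imageI) (auto simp: PiE_iff extensional_def)
    show "(\<lambda>\<omega>. F (\<lambda>s. X s \<omega>)) \<in> borel_measurable M"
      unfolding eq using X by (intro measurable_compose[OF _ meas] measurable_restrict)
  qed
qed

text \<open>
  Split \<open>F\<close> according to the value \<open>e\<close> of the fresh selection: each term is a function of the past
  times the indicator of an independent event of probability \<open>1 / CARD('e)\<close>.
\<close>

lemma (in prob_space) expectation_fresh_uniform:
  fixes X :: "nat \<Rightarrow> 'a \<Rightarrow> 'e::finite" and F :: "(nat \<Rightarrow> 'e) \<Rightarrow> 'e \<Rightarrow> real"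
  assumes iid: "iid_uniform M X"
    and past: "\<And>w w' e. (\<And>s. s < t \<Longrightarrow> w s = w' s) \<Longrightarrow> F w e = F w' e"
  shows "integrable M (\<lambda>\<omega>. F (\<lambda>s. X s \<omega>) (X t \<omega>))"
    and "integrable M (\<lambda>\<omega>. 1 / real CARD('e) * (\<Sum>e\<in>UNIV. F (\<lambda>s. X s \<omega>) e))"
    and "expectation (\<lambda>\<omega>. 1 / real CARD('e) * (\<Sum>e\<in>UNIV. F (\<lambda>s. X s \<omega>) e))
      = expectation (\<lambda>\<omega>. F (\<lambda>s. X s \<omega>) (X t \<omega>))"
proof -
  let ?U = "count_space (UNIV :: 'e set)"
  have ind: "indep_vars (\<lambda>_. ?U) X UNIV"
    and unif: "\<And>s. distr M ?U (X s) = uniform_count_measure UNIV"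
    using iid unfolding iid_uniform_def by auto
  have X: "X s \<in> measurable M ?U" for s
    using ind unfolding indep_vars_def by auto
  let ?G = "\<lambda>e \<omega>. F (\<lambda>s. X s \<omega>) e" and ?I = "\<lambda>e \<omega>. indicator {e} (X t \<omega>) :: real"
  have iG: "integrable M (?G e)" for e
    by (rule integrable_past[OF X, where t = t and F = "\<lambda>w. F w e"]) (rule past)
  have iI: "integrable M (?I e)" for e
    using X by (intro integrable_const_bound[of _ 1])
      (auto intro!: measurable_compose[OF X])
  have indep: "indep_var borel (?G e) borel (?I e)" for e
  proof -
    have "indep_var (PiM {..<t} (\<lambda>_. ?U)) (\<lambda>\<omega>. restrict (\<lambda>s. X s \<omega>) {..<t})
        (PiM {t} (\<lambda>_. ?U)) (\<lambda>\<omega>. restrict (\<lambda>s. X s \<omega>) {t})"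
      by (rule indep_var_restrict[OF ind]) auto
    then have "indep_var borel ((\<lambda>w. F w e) \<circ> (\<lambda>\<omega>. restrict (\<lambda>s. X s \<omega>) {..<t}))
        borel ((\<lambda>w. indicator {e} (w t) :: real) \<circ> (\<lambda>\<omega>. restrict (\<lambda>s. X s \<omega>) {t}))"
    proof (rule indep_var_compose)
      show "(\<lambda>w. F w e) \<in> borel_measurable (PiM {..<t} (\<lambda>_. ?U))"
        by (rule measurable_past[OF X]) (rule past)
      show "(\<lambda>w. indicator {e} (w t) :: real) \<in> borel_measurable (PiM {t} (\<lambda>_. ?U))"
        by (simp add: count_space_PiM_finite)
    qed
    moreover have "F (restrict (\<lambda>s. X s \<omega>) {..<t}) e = ?G e \<omega>" for \<omega>
      by (rule past) simp
    ultimately show ?thesis by (simp add: comp_def)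
  qed
  have EI: "expectation (?I e) = 1 / real CARD('e)" for e
  proof -
    have "expectation (?I e) = (\<integral>a. indicator {e} a \<partial>distr M ?U (X t))"
      by (rule integral_distr[symmetric]) (auto intro: X)
    then show ?thesis by (simp add: unif measure_uniform_count_measure)
  qed
  have prod: "integrable M (\<lambda>\<omega>. ?G e \<omega> * ?I e \<omega>)"
    "expectation (\<lambda>\<omega>. ?G e \<omega> * ?I e \<omega>) = expectation (?G e) * (1 / real CARD('e))" for e
    using indep_var_integrable[OF indep iG iI, of e]
      indep_var_lebesgue_integral[OF indep iG iI, of e] by (simp_all add: EI)
  have split: "F (\<lambda>s. X s \<omega>) (X t \<omega>) = (\<Sum>e\<in>UNIV. ?G e \<omega> * ?I e \<omega>)" for \<omega>
    by (simp add: indicator_def)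
  show "integrable M (\<lambda>\<omega>. F (\<lambda>s. X s \<omega>) (X t \<omega>))"
    unfolding split using prod(1) by (rule Bochner_Integration.integrable_sum)
  show "integrable M (\<lambda>\<omega>. 1 / real CARD('e) * (\<Sum>e\<in>UNIV. ?G e \<omega>))"
    using iG by (intro integrable_mult_right Bochner_Integration.integrable_sum) auto
  have "expectation (\<lambda>\<omega>. 1 / real CARD('e) * (\<Sum>e\<in>UNIV. ?G e \<omega>))
      = 1 / real CARD('e) * (\<Sum>e\<in>UNIV. expectation (?G e))"
    using iG by (simp add: Bochner_Integration.integral_sum)
  also have "\<dots> = (\<Sum>e\<in>UNIV. expectation (\<lambda>\<omega>. ?G e \<omega> * ?I e \<omega>))"
    by (simp add: prod(2) sum_distrib_left)
  also have "\<dots> = expectation (\<lambda>\<omega>. \<Sum>e\<in>UNIV. ?G e \<omega> * ?I e \<omega>)"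
    using prod(1) by (rule Bochner_Integration.integral_sum[symmetric])
  finally show "expectation (\<lambda>\<omega>. 1 / real CARD('e) * (\<Sum>e\<in>UNIV. ?G e \<omega>))
      = expectation (\<lambda>\<omega>. F (\<lambda>s. X s \<omega>) (X t \<omega>))"
    unfolding split .
qed

section \<open>The expected average gap\<close>

lemma oriented_edges_src_neq_dst:
  assumes "simple_graph E" and "oriented_edges E src dst"
  shows "src e \<noteq> dst e"
proof
  assume eq: "src e = dst e"
  have "{src e, dst e} \<in> E"
    using assms(2) unfolding oriented_edges_def bij_betw_def by auto
  then have "card {src e, dst e} = 2"
    using assms(1) unfolding simple_graph_def by blast
  then show False using eq by simp
qed

lemma gossip_x_past:
  assumes "\<And>s. s < t \<Longrightarrow> w s = w' s"
  shows "gossip_x src dst c \<epsilon> w t = gossip_x src dst c \<epsilon> w' t"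
proof -
  have "gossip_y src dst c \<epsilon> w t = gossip_y src dst c \<epsilon> w' t"
    using assms by (induction t) auto
  then show ?thesis by (simp add: gossip_x_def)
qed

theorem theorem9:
  fixes E :: "'v::finite set set"
    and src dst :: "'e::finite \<Rightarrow> 'v"
    and c :: "real ^ 'v"
    and ystar :: "real ^ 'e"
    and \<epsilon> :: real
    and M :: "'a measure"
    and \<xi> :: "nat \<Rightarrow> 'a \<Rightarrow> 'e"
    and k :: nat
  assumes "CARD('v) \<ge> 2"
    and "simple_graph E"
    and "connected_graph E"
    and "oriented_edges E src dst"
    and "\<forall>y. dual_obj src dst c y \<le> dual_obj src dst c ystar"
    and "\<epsilon> > 0"
    and "prob_space M"
    and "iid_uniform M \<xi>"
    and "k \<ge> 1"
  shows "avg_gap M \<xi> src dst c \<epsilon> k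
    \<le> 4 * (dual_obj src dst c ystar - dual_obj src dst c 0) / (real k * \<epsilon>\<^sup>2)"
proof -
  interpret prob_space M by fact
  let ?F = "\<lambda>t w e. gap_edge src dst \<epsilon> (gossip_x src dst c \<epsilon> w t) e"
  let ?S = "\<lambda>t \<omega>. ?F t (\<lambda>s. \<xi> s \<omega>) (\<xi> t \<omega>)"
  let ?gap = "\<lambda>t \<omega>. gap src dst \<epsilon> (gossip_x src dst c \<epsilon> (\<lambda>s. \<xi> s \<omega>) t)"
  let ?B = "4 * (dual_obj src dst c ystar - dual_obj src dst c 0) / \<epsilon>\<^sup>2"
  have past: "?F t w e = ?F t w' e" if "\<And>s. s < t \<Longrightarrow> w s = w' s" for t w w' e
    by (subst gossip_x_past[of t w w']) (simp_all add: that)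
  note fresh = expectation_fresh_uniform[OF \<open>iid_uniform M \<xi>\<close>, of _ "?F _", OF past]
  have intS: "integrable M (?S t)" for t by (rule fresh(1))
  have intgap: "integrable M (?gap t)" for t
    unfolding gap_def by (rule fresh(2))
  have swap: "expectation (?gap t) = expectation (?S t)" for t
    unfolding gap_def by (rule fresh(3))
  have "avg_gap M \<xi> src dst c \<epsilon> k = 1 / real k * (\<Sum>t<k. expectation (?gap t))"
    unfolding avg_gap_def using intgap by (simp add: Bochner_Integration.integral_sum)
  also have "\<dots> = 1 / real k * expectation (\<lambda>\<omega>. \<Sum>t<k. ?S t \<omega>)"
    using intS by (simp add: swap Bochner_Integration.integral_sum)
  also have "expectation (\<lambda>\<omega>. \<Sum>t<k. ?S t \<omega>) \<le> ?B"
  proof (rule integral_le_const)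
    show "integrable M (\<lambda>\<omega>. \<Sum>t<k. ?S t \<omega>)"
      using intS by (intro Bochner_Integration.integrable_sum)
    show "AE \<omega> in M. (\<Sum>t<k. ?S t \<omega>) \<le> ?B"
      using oriented_edges_src_neq_dst[OF assms(2,4)] assms(5,6)
      by (intro AE_I2 effective_steps_le) auto
  qed
  finally show ?thesis
    using \<open>k \<ge> 1\<close> by (simp add: field_simps)
qed

end
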